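(* Let $f:\mathbb{R}^{d_x}\times\mathbb{R}^{d_y}\to\mathbb{R}$ be twice continuously differentiable with $\rho$-Lipschitz continuous Hessians, convex in $x$ and concave in $y$, and having at least one saddle point. Let $z^*=(x^*,y^* )$ be a saddle point and $\beta=\|z_0-z^*\|$. Set $M\ge 3\rho m$. Then the sequence of iterates generated by LEN$(z_0,T,m,M)$ is bounded: $z_t\in\mathbb{B}_{\beta}(z^* )$ and $z_{t+1/2}\in\mathbb{B}_{3\beta}(z^* )$ for all $t=0,\dots,T-1$, and satisfies the following ergodic convergence for the output $\bar z_T=(\bar x_T,\bar y_T)$: $$\mathrm{Gap}(\bar x_T,\bar y_T;3\beta)\le \frac{32\,M\,\|z_0-z^*\|^3}{T^{3/2}}.$$ Let $M=3\rho m$. Then LEN finds an $\epsilon$-saddle point within $\mathcal{O}(m^{2/3}\epsilon^{-2/3})$ iterations.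
   Context: Notation: $d=d_x+d_y$, $z=(x,y)\in\mathbb{R}^d$, $\|\cdot\|$ is the Euclidean norm (spectral norm for matrices), $\mathbb{B}_r(w)$ is the ball of radius $r$ centered at $w$, and $m$ is a positive integer. $f$ has $\rho$-Lipschitz continuous Hessians if $\|\nabla^2 f(x,y)-\nabla^2 f(x',y')\|\le\rho\|(x,y)-(x',y')\|$ for all points. A saddle point is $(x^*,y^* )$ with $f(x^*,y)\le f(x^*,y^* )\le f(x,y^* )$ for all $x,y$. Let $F(z)=\begin{bmatrix}\nabla_x f(x,y)\\ -\nabla_y f(x,y)\end{bmatrix}$ and let $\nabla F(z)$ be its Jacobian. Restricted gap: for a point $(\hat x,\hat y)$ and $r$ sufficiently large that $\max\{\|\hat x-x^*\|,\|\hat y-y^*\|\}\le r$, $\mathrm{Gap}(\hat x,\hat y;r)=\max_{y\in\mathbb{B}_r(y^* )}f(\hat x,y)-\min_{x\in\mathbb{B}_r(x^* )}f(x,\hat y)$. The point $(\hat x,\hat y)$ is called an $\epsilon$-saddle point if $\mathrm{Gap}(\hat x,\hat y;r)\le\epsilon$ with $r=\Omega(\max\{\|x_0-x^*\|,\|y_0-y^*\|\})$, where $z_0=(x_0,y_0)$. Algorithm LEN$(z_0,T,m,M)$: let $\pi(t)=t-(t\bmod m)$. For $t=0,\dots,T-1$: (i) find $z_{t+1/2}$ that satisfies $F(z_t)=\big(\nabla F(z_{\pi(t)})+M\|z_t-z_{t+1/2}\| I_d\big)(z_t-z_{t+1/2})$; (ii) compute $\gamma_t=M\|z_t-z_{t+1/2}\|$;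 (iii) compute $z_{t+1}=z_t-\gamma_t^{-1}F(z_{t+1/2})$. Return $\bar z_T=\big(\sum_{t=0}^{T-1}\gamma_t^{-1}\big)^{-1}\sum_{t=0}^{T-1}\gamma_t^{-1}z_{t+1/2}$. *)

theory Defs
  imports "HOL-Analysis.Analysis" "HOL-Library.Landau_Symbols"
begin

definition grad :: "('a::euclidean_space \<Rightarrow> real) \<Rightarrow> 'a \<Rightarrow> 'a" where
  "grad f x = (THE D. GDERIV f x :> D)"

(* The Jacobian as a bounded linear map; the norm of this type is the operator norm,
   i.e. the spectral norm of the matrix. *)
definition Jac :: "('a::euclidean_space \<Rightarrow> 'b::euclidean_space) \<Rightarrow> 'a \<Rightarrow> 'a \<Rightarrow>\<^sub>L 'b" where
  "Jac G x = Blinfun (frechet_derivative G (at x))"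

definition hessian :: "('a::euclidean_space \<Rightarrow> real) \<Rightarrow> 'a \<Rightarrow> 'a \<Rightarrow>\<^sub>L 'a" where
  "hessian f = Jac (grad f)"

definition twice_cont_diff :: "('a::euclidean_space \<Rightarrow> real) \<Rightarrow> bool" where
  "twice_cont_diff f \<longleftrightarrow>
     (\<forall>x. f differentiable (at x)) \<and> (\<forall>x. grad f differentiable (at x)) \<and>
     continuous_on UNIV (hessian f)"

definition convex_concave :: "('a::euclidean_space \<times> 'b::euclidean_space \<Rightarrow> real) \<Rightarrow> bool" where
  "convex_concave f \<longleftrightarrow>
     (\<forall>y. convex_on UNIV (\<lambda>x. f (x, y))) \<and> (\<forall>x. concave_on UNIV (\<lambda>y. f (x, y)))"

definition saddle_point ::
  "('a::euclidean_space \<times> 'b::euclidean_space \<Rightarrow> real) \<Rightarrow> 'a \<times> 'b \<Rightarrow> bool" where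
  "saddle_point f zs \<longleftrightarrow>
     (\<forall>x y. f (fst zs, y) \<le> f (fst zs, snd zs) \<and> f (fst zs, snd zs) \<le> f (x, snd zs))"

definition saddle_op ::
  "('a::euclidean_space \<times> 'b::euclidean_space \<Rightarrow> real) \<Rightarrow> 'a \<times> 'b \<Rightarrow> 'a \<times> 'b" where
  "saddle_op f z = (grad (\<lambda>x. f (x, snd z)) (fst z), - grad (\<lambda>y. f (fst z, y)) (snd z))"

(* For continuous f and r >= 0 both extrema are attained, the balls being compact. *)
definition Gap ::
  "('a::euclidean_space \<times> 'b::euclidean_space \<Rightarrow> real) \<Rightarrow> 'a \<times> 'b \<Rightarrow> 'a \<times> 'b \<Rightarrow> real \<Rightarrow> real" where
  "Gap f zs zh r =
     (SUP y\<in>cball (snd zs) r. f (fst zh, y)) - (INF x\<in>cball (fst zs) r. f (x, snd zh))"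

definition comp_dist :: "'a::euclidean_space \<times> 'b::euclidean_space \<Rightarrow> 'a \<times> 'b \<Rightarrow> real" where
  "comp_dist z zs = max (norm (fst z - fst zs)) (norm (snd z - snd zs))"

(* c is the constant hidden in the requirement r = Omega(comp_dist z0 zs); it carries content
   only when it is chosen before the problem instance, so it is a parameter. *)
definition eps_saddle ::
  "real \<Rightarrow> ('a::euclidean_space \<times> 'b::euclidean_space \<Rightarrow> real) \<Rightarrow> 'a \<times> 'b \<Rightarrow> 'a \<times> 'b \<Rightarrow>
   real \<Rightarrow> 'a \<times> 'b \<Rightarrow> bool" where
  "eps_saddle c f z0 zs \<epsilon> zh \<longleftrightarrow>
     (\<exists>r. c * comp_dist z0 zs \<le> r \<and> comp_dist zh zs \<le> r \<and> Gap f zs zh r \<le> \<epsilon>)"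

definition LEN_gamma :: "real \<Rightarrow> (nat \<Rightarrow> 'z::euclidean_space) \<Rightarrow> (nat \<Rightarrow> 'z) \<Rightarrow> nat \<Rightarrow> real" where
  "LEN_gamma M z zh t = M * norm (z t - zh t)"

(* z and zh are the iterates z_t and z_(t+1/2) of an execution of T iterations. The implicit
   equation need not determine z_(t+1/2), hence a relation.
   If gamma_t = 0, then inverse 0 = 0 makes the iterates stay put, z_(t+1) = z_t. *)
definition LEN ::
  "('a::euclidean_space \<times> 'b::euclidean_space \<Rightarrow> real) \<Rightarrow> 'a \<times> 'b \<Rightarrow> nat \<Rightarrow> nat \<Rightarrow> real \<Rightarrow>
   (nat \<Rightarrow> 'a \<times> 'b) \<Rightarrow> (nat \<Rightarrow> 'a \<times> 'b) \<Rightarrow> bool" where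
  "LEN f z0 T m M z zh \<longleftrightarrow>
     z 0 = z0 \<and>
     (\<forall>t<T.
        saddle_op f (z t) =
          blinfun_apply
            (Jac (saddle_op f) (z (t - t mod m)) + (M * norm (z t - zh t)) *\<^sub>R id_blinfun)
            (z t - zh t) \<and>
        z (Suc t) = z t - inverse (LEN_gamma M z zh t) *\<^sub>R saddle_op f (zh t))"

(* The weights gamma_t^(-1) are meaningful only for gamma_t > 0. For M > 0, gamma_t = 0 means
   z_(t+1/2) = z_t and F(z_t) = 0; the method has then stopped at z_(t+1/2), which is the
   output (the limit of the weighted average as that weight tends to infinity). *)
definition LEN_output ::
  "nat \<Rightarrow> real \<Rightarrow> (nat \<Rightarrow> 'z::euclidean_space) \<Rightarrow> (nat \<Rightarrow> 'z) \<Rightarrow> 'z" where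
  "LEN_output T M z zh =
     (if \<exists>t<T. LEN_gamma M z zh t = 0 then zh (LEAST t. LEN_gamma M z zh t = 0)
      else inverse (\<Sum>t<T. inverse (LEN_gamma M z zh t)) *\<^sub>R
           (\<Sum>t<T. inverse (LEN_gamma M z zh t) *\<^sub>R zh t))"

end

theory Submission
  imports Defs
begin

text \<open>
  The saddle operator F is monotone, its Jacobian is Lipschitz, and
  f(x, y') - f(x', y) is at most F(z) \<bullet> (z - u) for z = (x, y) and u = (x', y').
  Expanding squared distances, one step changes half the squared distance to any u by at most
  minus the weighted regret, minus half the squared half-step length, plus half the squared
  residual of z(t+1) against z(t+1/2). By Taylor expansion the residual is at most a
  multiple rho/M of the half-step length plus the drift from the last snapshot. Summed over an epoch
  of length m, the squared drifts cost at most m^2/2 times the squared step lengths, which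
  M \<ge> 3 rho m lets the negative terms absorb. Hence the iterates stay in the ball around the saddle
  point, the squared half-step lengths have sum at most 4 beta^2, and so the weights
  have sum at least T powr (3/2) / (2 M beta), which dominates the averaged regret.
\<close>

section \<open>Gradients, Jacobians and the saddle operator\<close>

lemma GDERIV_unique:
  assumes "GDERIV f x :> D" and "GDERIV f x :> D'"
  shows "D = D'"
proof -
  have "(\<lambda>h. h \<bullet> D) = (\<lambda>h. h \<bullet> D')"
    using assms unfolding gderiv_def by (rule has_derivative_unique)
  then have "(D - D') \<bullet> D = (D - D') \<bullet> D'"
    by metis
  then have "(D - D') \<bullet> (D - D') = 0"
    by (simp add: inner_diff_right)
  then show ?thesis by simp
qed

lemma grad_eqI: "GDERIV f x :> D \<Longrightarrow> grad f x = D"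
  unfolding grad_def using GDERIV_unique by blast

lemma GDERIV_grad:
  fixes f :: "'a::euclidean_space \<Rightarrow> real"
  assumes "f differentiable (at x)"
  shows "GDERIV f x :> grad f x"
proof -
  obtain f' where f': "(f has_derivative f') (at x)"
    using assms by (auto simp: differentiable_def)
  have "linear f'"
    using f' has_derivative_linear by blast
  \<comment> \<open>\<open>adjoint f' 1\<close> is the Riesz representative of the functional
    \<open>f'\<close>, which supplies the witness for the definite description in
    \<open>grad\<close>.\<close>
  then have "h \<bullet> adjoint f' 1 = f' h" for h
    by (simp add: adjoint_works)
  then have "GDERIV f x :> adjoint f' 1"
    unfolding gderiv_def using f' by simp
  then show ?thesis
    using grad_eqI by metis
qed

lemma blinfun_apply_Jac:
  fixes G :: "'a::euclidean_space \<Rightarrow> 'b::euclidean_space"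
  assumes "(G has_derivative G') (at x)"
  shows "blinfun_apply (Jac G x) = G'"
  using assms has_derivative_bounded_linear[OF assms] unfolding Jac_def
  by (simp add: bounded_linear_Blinfun_apply frechet_derivative_at[symmetric])

lemma has_derivative_Jac:
  fixes G :: "'a::euclidean_space \<Rightarrow> 'b::euclidean_space"
  assumes "G differentiable (at x)"
  shows "(G has_derivative blinfun_apply (Jac G x)) (at x)"
proof -
  have "(G has_derivative frechet_derivative G (at x)) (at x)"
    using assms frechet_derivative_works by blast
  then show ?thesis
    by (simp only: blinfun_apply_Jac)
qed

lemma GDERIV_partial:
  fixes f :: "'a::euclidean_space \<times> 'b::euclidean_space \<Rightarrow> real"
  assumes "GDERIV f (x, y) :> D"
  shows "GDERIV (\<lambda>u. f (u, y)) x :> fst D" and "GDERIV (\<lambda>v. f (x, v)) y :> snd D"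
proof -
  have f: "(f has_derivative (\<lambda>h. h \<bullet> D)) (at (x, y))"
    using assms by (simp add: gderiv_def)
  have "((\<lambda>u. (u, y)) has_derivative (\<lambda>h. (h, 0))) (at x)"
    by (auto intro!: derivative_eq_intros)
  from diff_chain_at[OF this f] show "GDERIV (\<lambda>u. f (u, y)) x :> fst D"
    by (simp add: gderiv_def o_def inner_prod_def)
  have "((\<lambda>v. (x, v)) has_derivative (\<lambda>h. (0, h))) (at y)"
    by (auto intro!: derivative_eq_intros)
  from diff_chain_at[OF this f] show "GDERIV (\<lambda>v. f (x, v)) y :> snd D"
    by (simp add: gderiv_def o_def inner_prod_def)
qed

lemma saddle_op_eq_grad:
  assumes "f differentiable (at z)"
  shows "saddle_op f z = (fst (grad f z), - snd (grad f z))"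
proof -
  have "GDERIV f (fst z, snd z) :> grad f z"
    using GDERIV_grad[OF assms] by simp
  from GDERIV_partial[OF this, THEN grad_eqI] show ?thesis
    by (simp add: saddle_op_def)
qed

lemma saddle_op_has_derivative:
  assumes "twice_cont_diff f"
  shows "(saddle_op f has_derivative
           (\<lambda>h. (fst (hessian f z h), - snd (hessian f z h)))) (at z)"
proof -
  have "saddle_op f = (\<lambda>z. (fst (grad f z), - snd (grad f z)))"
  proof
    show "saddle_op f z = (fst (grad f z), - snd (grad f z))" for z
      using assms unfolding twice_cont_diff_def by (intro saddle_op_eq_grad) blast
  qed
  moreover have "(grad f has_derivative blinfun_apply (hessian f z)) (at z)"
    using assms unfolding twice_cont_diff_def hessian_def by (blast intro: has_derivative_Jac)
  ultimately show ?thesis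
    by (simp only:) (intro has_derivative_Pair has_derivative_fst has_derivative_snd has_derivative_minus)
qed

lemma Jac_saddle_op:
  assumes "twice_cont_diff f"
  shows "(saddle_op f has_derivative blinfun_apply (Jac (saddle_op f) z)) (at z)"
    and "Jac (saddle_op f) z h = (fst (hessian f z h), - snd (hessian f z h))"
  unfolding blinfun_apply_Jac[OF saddle_op_has_derivative[OF assms]]
  by (rule saddle_op_has_derivative[OF assms], rule refl)

text \<open>The Jacobian of the saddle operator is the Hessian followed by a sign change of the
  second component. That sign change is an isometry, so the Lipschitz constant is inherited.\<close>

lemma lipschitz_Jac_saddle_op:
  assumes "twice_cont_diff f" and "\<rho>-lipschitz_on UNIV (hessian f)"
  shows "\<rho>-lipschitz_on UNIV (Jac (saddle_op f))"
proof (rule lipschitz_onI)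
  show "0 \<le> \<rho>"
    using assms(2) lipschitz_on_nonneg by blast
  fix z w
  have "norm (Jac (saddle_op f) z - Jac (saddle_op f) w) \<le> norm (hessian f z - hessian f w)"
  proof (rule norm_blinfun_bound)
    fix h
    have "norm ((Jac (saddle_op f) z - Jac (saddle_op f) w) h) = norm ((hessian f z - hessian f w) h)"
      by (simp add: blinfun.diff_left Jac_saddle_op(2)[OF assms(1)] norm_prod_def norm_minus_commute)
    also have "\<dots> \<le> norm (hessian f z - hessian f w) * norm h"
      by (rule norm_blinfun)
    finally show "norm ((Jac (saddle_op f) z - Jac (saddle_op f) w) h)
        \<le> norm (hessian f z - hessian f w) * norm h" .
  qed simp
  then show "dist (Jac (saddle_op f) z) (Jac (saddle_op f) w) \<le> \<rho> * dist z w"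
    using lipschitz_on_normD[OF assms(2), of z w] by (simp add: dist_norm)
qed

section \<open>First-order convexity and Taylor estimates\<close>

text \<open>Restricting \<open>g\<close> to the line through \<open>x\<close> and \<open>y\<close>
  reduces the claim to the one-dimensional tangent inequality at 0.\<close>

lemma convex_on_imp_above_grad:
  fixes g :: "'a::euclidean_space \<Rightarrow> real"
  assumes "convex_on UNIV g" and "GDERIV g x :> D"
  shows "(y - x) \<bullet> D \<le> g y - g x"
proof -
  define p where "p t = x + t *\<^sub>R (y - x)" for t :: real
  have p: "(p has_derivative (\<lambda>t. t *\<^sub>R (y - x))) (at 0)"
    unfolding p_def by (auto intro!: derivative_eq_intros)
  have "convex_on UNIV (g \<circ> p)"
  proof (rule convex_onI)
    fix t a b :: real
    assume t: "0 < t" "t < 1"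
    have "p ((1 - t) *\<^sub>R a + t *\<^sub>R b) = (1 - t) *\<^sub>R p a + t *\<^sub>R p b"
      by (simp add: p_def algebra_simps)
    then show "(g \<circ> p) ((1 - t) *\<^sub>R a + t *\<^sub>R b) \<le> (1 - t) * (g \<circ> p) a + t * (g \<circ> p) b"
      using convex_onD[OF assms(1), of t "p a" "p b"] t by simp
  qed simp
  moreover have "(g has_derivative (\<lambda>h. h \<bullet> D)) (at (p 0))"
    using assms(2) by (simp add: gderiv_def p_def)
  from diff_chain_at[OF p this]
  have "(g \<circ> p has_real_derivative (y - x) \<bullet> D) (at 0)"
    by (simp add: o_def has_field_derivative_def mult_commute_abs)
  ultimately have "((y - x) \<bullet> D) * (1 - 0) \<le> (g \<circ> p) 1 - (g \<circ> p) 0"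
    by (intro convex_on_imp_above_tangent[of UNIV]) (simp_all del: o_apply)
  then show ?thesis by (simp add: p_def)
qed

text \<open>Adding the tangent inequalities for f in the first variable and -f in the second cancels
  f(x, y). The minus sign in \<open>saddle_op\<close> turns the sum into a single inner
  product.\<close>

lemma convex_concave_gap_le:
  fixes f :: "'a::euclidean_space \<times> 'b::euclidean_space \<Rightarrow> real"
  assumes "convex_concave f" and "f differentiable (at z)"
  shows "f (fst z, snd u) - f (fst u, snd z) \<le> saddle_op f z \<bullet> (z - u)"
proof -
  obtain x y x' y' where [simp]: "z = (x, y)" "u = (x', y')"
    by (metis surj_pair)
  have D: "GDERIV f (x, y) :> grad f z"
    using GDERIV_grad[OF assms(2)] by simp
  have "(x' - x) \<bullet> fst (grad f z) \<le> f (x', y) - f (x, y)"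
    using assms(1) GDERIV_partial(1)[OF D]
    by (intro convex_on_imp_above_grad) (simp_all add: convex_concave_def)
  moreover have "(y' - y) \<bullet> - snd (grad f z) \<le> - f (x, y') - - f (x, y)"
    using assms(1) GDERIV_minus[OF GDERIV_partial(2)[OF D]]
    by (intro convex_on_imp_above_grad[where g = "\<lambda>v. - f (x, v)"])
      (simp_all add: convex_concave_def concave_on_def)
  ultimately show ?thesis
    using saddle_op_eq_grad[OF assms(2)]
    by (simp add: inner_diff_right inner_diff_left inner_commute)
qed

text \<open>Mean value inequality along the segment: once the linear part is subtracted, the
  derivative at time t is the change of \<open>J\<close> over a distance t |h|, applied to
  \<open>h\<close>. Its norm is at most rho |h|^2 t, the derivative of the quadratic
  majorant.\<close>

lemma norm_taylor_lipschitz_derivative: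
  fixes F :: "'z::euclidean_space \<Rightarrow> 'z"
  assumes deriv: "\<And>x. (F has_derivative blinfun_apply (J x)) (at x)"
    and lip: "\<rho>-lipschitz_on UNIV J"
  shows "norm (F w - F z - J z (w - z)) \<le> \<rho> / 2 * (norm (w - z))\<^sup>2"
proof -
  define h where "h = w - z"
  define g where "g t = F (z + t *\<^sub>R h) - t *\<^sub>R J z h" for t :: real
  have g': "(g has_vector_derivative J (z + t *\<^sub>R h) h - J z h) (at t)" for t
  proof -
    have "((\<lambda>t. z + t *\<^sub>R h) has_derivative (\<lambda>t. t *\<^sub>R h)) (at t)"
      by (auto intro!: derivative_eq_intros)
    from has_derivative_compose[OF this deriv]
    have "((\<lambda>t. F (z + t *\<^sub>R h)) has_derivative (\<lambda>s. s *\<^sub>R J (z + t *\<^sub>R h) h)) (at t)"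
      unfolding blinfun.scaleR_right .
    then show ?thesis
      unfolding g_def has_vector_derivative_def
      by (auto intro!: derivative_eq_intros simp: scaleR_diff_right)
  qed
  have \<phi>': "((\<lambda>t. \<rho> / 2 * (norm h)\<^sup>2 * t\<^sup>2) has_vector_derivative \<rho> * (norm h)\<^sup>2 * t) (at t)" for t :: real
    unfolding has_real_derivative_iff_has_vector_derivative[symmetric]
    by (auto intro!: derivative_eq_intros)
  have "norm (g 1 - g 0) \<le> \<rho> / 2 * (norm h)\<^sup>2 * 1\<^sup>2 - \<rho> / 2 * (norm h)\<^sup>2 * 0\<^sup>2"
  proof (rule differentiable_bound_general[OF _ _ _ g' \<phi>'])
    show "continuous_on {0..1} g"
      by (metis continuous_at_imp_continuous_on g' has_vector_derivative_continuous)
    show "continuous_on {0..1} (\<lambda>t. \<rho> / 2 * (norm h)\<^sup>2 * t\<^sup>2)"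
      by (intro continuous_intros)
    fix t :: real
    assume t: "0 < t" "t < 1"
    have "norm (J (z + t *\<^sub>R h) h - J z h) \<le> norm (J (z + t *\<^sub>R h) - J z) * norm h"
      by (metis blinfun.diff_left norm_blinfun)
    also have "\<dots> \<le> (\<rho> * norm ((z + t *\<^sub>R h) - z)) * norm h"
      by (intro mult_right_mono lipschitz_on_normD[OF lip]) auto
    also have "\<dots> = \<rho> * (norm h)\<^sup>2 * t"
      using t by (simp add: power2_eq_square)
    finally show "norm (J (z + t *\<^sub>R h) h - J z h) \<le> \<rho> * (norm h)\<^sup>2 * t" .
  qed auto
  then show ?thesis
    by (simp add: g_def h_def algebra_simps)
qed

section \<open>Summation inequalities\<close>

text \<open>After exchanging the sums, \<open>r i\<close> is charged \<open>t mod m\<close> by every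
  later t of its epoch, in total at most 1 + ... + (m-1). Since \<open>T\<close> may cut an epoch
  short, the induction carries a reserve for the charges still to come.\<close>

lemma sum_lazy_epochs_le:
  fixes r :: "nat \<Rightarrow> real"
  assumes r: "\<And>i. 0 \<le> r i" and m: "1 \<le> m"
  shows "(\<Sum>t<T. real (t mod m) * (\<Sum>i = t - t mod m..<t. r i)) \<le> (real m)\<^sup>2 / 2 * (\<Sum>i<T. r i)"
proof -
  define S where "S t = (\<Sum>i = t - t mod m..<t. r i)" for t
  \<comment> \<open>\<open>R k\<close> equals k + (k+1) + ... + (m-1), the weight still to be
    charged to the open window \<open>S\<close> from offset k on.\<close>
  define R where "R k = (real m * (real m - 1) - k * (k - 1)) / 2" for k
  have R_Suc: "R (1 + k) = R k - k" for k
    by (simp add: R_def field_simps)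
  have "(\<Sum>t<T. real (t mod m) * S t) + R (real (T mod m)) * S T \<le> (real m)\<^sup>2 / 2 * (\<Sum>i<T. r i)"
  proof (induction T)
    case 0
    then show ?case by (simp add: S_def)
  next
    case (Suc T)
    let ?k = "real (T mod m)"
    have "?k * S T + R (real (Suc T mod m)) * S (Suc T) \<le> R ?k * S T + (real m)\<^sup>2 / 2 * r T"
    \<comment> \<open>At the last offset k = m-1 the reserve is \<open>R k = k\<close>, which pays
      exactly the final charge, and the window empties. Otherwise \<open>r T\<close> joins the
      window with the whole remaining weight \<open>R (1 + k)\<close>.\<close>
    proof (cases "Suc (T mod m) = m")
      case True
      then have "Suc T mod m = 0" and k: "?k = real m - 1"
        by (auto simp: mod_Suc)
      then have "S (Suc T) = 0"
        by (simp add: S_def)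
      moreover have "R ?k = ?k"
        unfolding k by (simp add: R_def field_simps)
      ultimately show ?thesis
        using r[of T] by simp
    next
      case False
      then have k: "Suc T mod m = Suc (T mod m)"
        by (simp add: mod_Suc)
      then have "S (Suc T) = S T + r T"
        by (simp add: S_def)
      then have "?k * S T + R (real (Suc T mod m)) * S (Suc T) = R ?k * S T + R (1 + ?k) * r T"
        by (simp add: k R_Suc algebra_simps)
      also have "R (1 + ?k) \<le> (real m)\<^sup>2 / 2"
        using m by (simp add: R_def power2_eq_square field_simps)
      then have "R (1 + ?k) * r T \<le> (real m)\<^sup>2 / 2 * r T"
        using r by (rule mult_right_mono)
      finally show ?thesis by simp
    qed
    then show ?case
      using Suc.IH by (simp add: algebra_simps)
  qed
  moreover have "0 \<le> R (real (T mod m)) * S T"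
  proof -
    have "Suc (T mod m) \<le> m"
      using m by (simp add: Suc_leI)
    then have k: "real (T mod m) \<le> real m - 1"
      by linarith
    have "real (T mod m) * (real (T mod m) - 1) \<le> real m * (real m - 1)"
    \<comment> \<open>For k = 0 the factor k - 1 is negative, so monotonicity of products is applied
      only to positive k.\<close>
    proof (cases "T mod m = 0")
      case False
      then show ?thesis
        using k by (intro mult_mono) auto
    qed (use m in simp)
    then show ?thesis
      using r by (auto simp: R_def S_def intro!: mult_nonneg_nonneg sum_nonneg)
  qed
  ultimately show ?thesis
    by (simp add: S_def)
qed

text \<open>Cauchy-Schwarz for the telescoping sum of steps; the factor is the number of
  steps.\<close>

lemma norm_diff_squared_le_sum:
  fixes z :: "nat \<Rightarrow> 'z::real_normed_vector"
  assumes "s \<le> t"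
  shows "(norm (z t - z s))\<^sup>2 \<le> real (t - s) * (\<Sum>i = s..<t. (norm (z i - z (Suc i)))\<^sup>2)"
proof -
  have "norm (z t - z s) = norm (\<Sum>i = s..<t. z (Suc i) - z i)"
    using assms by (simp add: sum_Suc_diff')
  also have "\<dots> \<le> (\<Sum>i = s..<t. norm (z i - z (Suc i)))"
    by (rule order_trans[OF norm_sum]) (simp add: norm_minus_commute)
  finally have "(norm (z t - z s))\<^sup>2 \<le> (\<Sum>i = s..<t. norm (z i - z (Suc i)))\<^sup>2"
    by (simp add: power_mono)
  also have "\<dots> \<le> (\<Sum>i = s..<t. (norm (z i - z (Suc i)))\<^sup>2) * card {s..<t}"
    by (rule sum_squared_le_sum_of_squares)
  finally show ?thesis
    by (simp add: mult.commute)
qed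

text \<open>The inverse is a convex function of the square, so the extremal case has all
  \<open>g t\<close> equal to B / sqrt T. Rescaling by that value \<open>c\<close> moves the case to
  1, where a tangent bound is summed termwise.\<close>

lemma sum_inverse_ge:
  fixes g :: "nat \<Rightarrow> real"
  assumes pos: "\<And>t. t < T \<Longrightarrow> 0 < g t" and B: "0 < B" and le: "(\<Sum>t<T. (g t)\<^sup>2) \<le> B\<^sup>2" and T: "1 \<le> T"
  shows "real T powr (3/2) / B \<le> (\<Sum>t<T. inverse (g t))"
proof -
  define c where "c = B / sqrt (real T)"
  have c: "0 < c" and c2: "B\<^sup>2 / c\<^sup>2 = real T"
    using B T by (simp_all add: c_def power_divide)
  \<comment> \<open>the tangent to s \<mapsto> s powr (-1/2) at s = 1, evaluated at s = x^2\<close>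
  have tangent: "(3 - x\<^sup>2) / 2 \<le> inverse x" if "0 < x" for x :: real
  proof -
    \<comment> \<open>The product expands to x^3 - 3 x + 2.\<close>
    have "0 \<le> (x - 1)\<^sup>2 * (x + 2)"
      using that by simp
    then have "(3 - x\<^sup>2) / 2 * x \<le> 1"
      by (simp add: power2_eq_square algebra_simps)
    then have "(3 - x\<^sup>2) / 2 \<le> 1 / x"
      using that by (simp only: pos_le_divide_eq)
    then show ?thesis
      by (simp only: inverse_eq_divide)
  qed
  have "(\<Sum>t<T. (g t / c)\<^sup>2) = (\<Sum>t<T. (g t)\<^sup>2) / c\<^sup>2"
    by (simp add: power_divide sum_divide_distrib)
  also have "\<dots> \<le> B\<^sup>2 / c\<^sup>2"
    using le by (rule divide_right_mono) simp
  finally have "real T \<le> (3 * real T - (\<Sum>t<T. (g t / c)\<^sup>2)) / 2"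
    unfolding c2 by simp
  also have "\<dots> = (\<Sum>t<T. (3 - (g t / c)\<^sup>2) / 2)"
    by (simp add: sum_subtractf flip: sum_divide_distrib)
  also have "\<dots> \<le> (\<Sum>t<T. inverse (g t / c))"
    using c pos by (intro sum_mono tangent) simp
  also have "\<dots> = c * (\<Sum>t<T. inverse (g t))"
    by (simp add: sum_distrib_left divide_inverse mult.commute)
  finally have "real T / c \<le> (\<Sum>t<T. inverse (g t))"
    using c by (simp add: pos_divide_le_eq mult.commute)
  moreover have "real T powr (3/2) = real T * sqrt (real T)"
  proof -
    have "real T powr (3/2) = real T powr (1 + 1/2)"
      by simp
    also have "\<dots> = real T powr 1 * real T powr (1/2)"
      by (rule powr_add)
    finally show ?thesis
      using T by (simp add: powr_half_sqrt)
  qed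
  ultimately show ?thesis
    by (simp add: c_def)
qed

section \<open>Energy estimate for an abstract run\<close>

text \<open>A run of \<open>LEN\<close> for an operator \<open>F\<close> with Lipschitz Jacobian
  \<open>J\<close>, where \<open>z (t - t mod m)\<close> is the snapshot at which the Jacobian is
  taken. The saddle structure stays outside; sign information on \<open>F\<close> enters in the
  later context that fixes \<open>zs\<close>.\<close>

locale lazy_extra_newton =
  fixes F :: "'z::euclidean_space \<Rightarrow> 'z" and J :: "'z \<Rightarrow> 'z \<Rightarrow>\<^sub>L 'z"
    and \<rho> M :: real and m T :: nat and z zh :: "nat \<Rightarrow> 'z"
  assumes deriv: "(F has_derivative blinfun_apply (J x)) (at x)"
    and lip: "\<rho>-lipschitz_on UNIV J"
    and m: "1 \<le> m" and M: "0 < M" "3 * \<rho> * real m \<le> M"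
    and half_step: "t < T \<Longrightarrow>
      F (z t) = J (z (t - t mod m)) (z t - zh t) + (M * norm (z t - zh t)) *\<^sub>R (z t - zh t)"
    and step: "t < T \<Longrightarrow> z (Suc t) = z t - inverse (LEN_gamma M z zh t) *\<^sub>R F (zh t)"
begin

abbreviation "\<gamma> \<equiv> LEN_gamma M z zh"

lemma gamma_eq_0_iff: "\<gamma> t = 0 \<longleftrightarrow> zh t = z t"
  using M(1) by (auto simp: LEN_gamma_def)

lemma gamma_nonneg: "0 \<le> \<gamma> t"
  using M(1) by (simp add: LEN_gamma_def)

lemma stationary:
  assumes "t < T" "\<gamma> t = 0"
  shows "F (zh t) = 0"
  using half_step[OF assms(1)] assms(2) by (simp add: gamma_eq_0_iff)

text \<open>By the implicit equation, gamma times the residual is a Taylor remainder at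
  \<open>z t\<close> plus the error of the stale Jacobian. Both carry a factor |v|, which cancels
  against gamma = M |v|; then rho / M <= 1 / (3 m) gives the constant.\<close>

lemma extragradient_residual:
  assumes t: "t < T"
  shows "norm (z (Suc t) - zh t)
      \<le> (norm (z t - zh t) / 2 + norm (z t - z (t - t mod m))) / (3 * real m)"
\<comment> \<open>If gamma is zero, \<open>inverse 0 = 0\<close> gives
  \<open>z (Suc t) = z t\<close>, which is also \<open>zh t\<close>, and the residual
  vanishes.\<close>
proof (cases "\<gamma> t = 0")
  case True
  then show ?thesis
    using step[OF t] gamma_eq_0_iff[of t] by simp
next
  case False
  define v where "v = z t - zh t"
  define \<pi> where "\<pi> = t - t mod m"
  have \<gamma>: "\<gamma> t = M * norm v" "0 < \<gamma> t"
    using False gamma_nonneg[of t] by (simp add: LEN_gamma_def v_def, linarith)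
  then have v: "0 < norm v"
    using M(1) by (simp add: zero_less_mult_iff)
  have \<rho>: "0 \<le> \<rho>" "\<rho> / M \<le> 1 / (3 * real m)"
    using lip lipschitz_on_nonneg M m by (auto simp: field_simps)
  have "\<gamma> t *\<^sub>R (z (Suc t) - zh t) = \<gamma> t *\<^sub>R v - F (zh t)"
    using \<gamma>(2) by (simp add: step[OF t] v_def algebra_simps)
  also have "\<gamma> t *\<^sub>R v = F (z t) - J (z \<pi>) v"
    using half_step[OF t] by (simp add: \<gamma>(1) v_def \<pi>_def)
  also have "F (z t) - J (z \<pi>) v - F (zh t)
      = - (F (zh t) - F (z t) - J (z t) (zh t - z t)) + (J (z t) - J (z \<pi>)) v"
    by (simp add: v_def blinfun.diff_left blinfun.diff_right)
  finally have "\<gamma> t * norm (z (Suc t) - zh t)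
      = norm (- (F (zh t) - F (z t) - J (z t) (zh t - z t)) + (J (z t) - J (z \<pi>)) v)"
    using \<gamma>(2) norm_scaleR[of "\<gamma> t" "z (Suc t) - zh t"] by simp
  also have "\<dots> \<le> norm (F (zh t) - F (z t) - J (z t) (zh t - z t)) + norm ((J (z t) - J (z \<pi>)) v)"
    by (rule order_trans[OF norm_triangle_ineq]) (simp only: norm_minus_cancel)
  also have "\<dots> \<le> \<rho> / 2 * (norm (zh t - z t))\<^sup>2 + norm (J (z t) - J (z \<pi>)) * norm v"
    by (intro add_mono norm_taylor_lipschitz_derivative deriv lip norm_blinfun)
  also have "\<dots> \<le> \<rho> / 2 * (norm v)\<^sup>2 + (\<rho> * norm (z t - z \<pi>)) * norm v"
    unfolding v_def
    by (intro add_mono mult_right_mono lipschitz_on_normD[OF lip]) (auto simp: norm_minus_commute)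
  finally have "norm v * (M * norm (z (Suc t) - zh t)) \<le> norm v * (\<rho> * (norm v / 2 + norm (z t - z \<pi>)))"
    by (simp add: \<gamma>(1) power2_eq_square algebra_simps)
  then have "M * norm (z (Suc t) - zh t) \<le> \<rho> * (norm v / 2 + norm (z t - z \<pi>))"
    using v by (rule mult_left_le_imp_le)
  then have "norm (z (Suc t) - zh t) \<le> \<rho> / M * (norm v / 2 + norm (z t - z \<pi>))"
    using M(1) by (simp add: pos_le_divide_eq mult.commute)
  also have "\<dots> \<le> 1 / (3 * real m) * (norm v / 2 + norm (z t - z \<pi>))"
    by (intro mult_right_mono \<rho>) simp
  finally show ?thesis
    by (simp add: v_def \<pi>_def)
qed

text \<open>Expanding squares leaves -v^2/2 + s^2/2 besides the distances to \<open>u\<close>. The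
  negative part has to provide v^2/8 on the left, the -r^2/8 that later absorbs the drifts, and
  compensation for the residual s.\<close>

lemma step_energy:
  assumes t: "t < T"
  shows "inverse (\<gamma> t) * (F (zh t) \<bullet> (zh t - u)) + (norm (z (Suc t) - u))\<^sup>2 / 2 + (norm (z t - zh t))\<^sup>2 / 8
    \<le> (norm (z t - u))\<^sup>2 / 2 - (norm (z t - z (Suc t)))\<^sup>2 / 8
      + (norm (z t - z (t - t mod m)))\<^sup>2 / (6 * (real m)\<^sup>2)"
proof -
  define v r s e where "v = norm (z t - zh t)" and "r = norm (z t - z (Suc t))"
    and "s = norm (z (Suc t) - zh t)" and "e = norm (z t - z (t - t mod m))"
  \<comment> \<open>For gamma zero both sides are zero, since \<open>inverse 0 = 0\<close> also
    freezes \<open>z\<close>.\<close>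
  have "inverse (\<gamma> t) * (F (zh t) \<bullet> (zh t - u)) = (z t - z (Suc t)) \<bullet> (zh t - u)"
    by (simp add: step[OF t])
  also have "\<dots> = ((norm (z t - u))\<^sup>2 - (norm (z (Suc t) - u))\<^sup>2 - v\<^sup>2 + s\<^sup>2) / 2"
    by (simp add: v_def s_def power2_norm_eq_inner inner_diff_left inner_diff_right inner_commute field_simps)
  finally have main: "inverse (\<gamma> t) * (F (zh t) \<bullet> (zh t - u)) + (norm (z (Suc t) - u))\<^sup>2 / 2
      = (norm (z t - u))\<^sup>2 / 2 - v\<^sup>2 / 2 + s\<^sup>2 / 2"
    by (simp add: field_simps)
  have "r \<le> v + s"
    unfolding r_def v_def s_def
    using dist_triangle2[of "z t" "z (Suc t)" "zh t"] by (simp add: dist_norm)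
  then have "r\<^sup>2 \<le> (v + s)\<^sup>2"
    by (simp add: r_def power_mono)
  also have "\<dots> \<le> 2 * v\<^sup>2 + 2 * s\<^sup>2"
    using zero_le_power2[of "v - s"] by (simp add: power2_eq_square algebra_simps)
  finally have r: "r\<^sup>2 \<le> 2 * v\<^sup>2 + 2 * s\<^sup>2" .
  have "s\<^sup>2 \<le> ((v / 2 + e) / (3 * real m))\<^sup>2"
    using extragradient_residual[OF t] by (intro power_mono) (simp_all add: v_def s_def e_def)
  also have "\<dots> = (v / 2 + e)\<^sup>2 / (9 * (real m)\<^sup>2)"
    by (simp add: power_divide power_mult_distrib)
  also have "\<dots> \<le> (v\<^sup>2 / 2 + 2 * e\<^sup>2) / (9 * (real m)\<^sup>2)"
    using zero_le_power2[of "v / 2 - e"]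
    by (intro divide_right_mono) (simp_all add: power2_eq_square algebra_simps)
  also have "\<dots> = v\<^sup>2 / (18 * (real m)\<^sup>2) + 2 * e\<^sup>2 / (9 * (real m)\<^sup>2)"
    by (simp add: add_divide_distrib)
  also have "v\<^sup>2 / (18 * (real m)\<^sup>2) \<le> v\<^sup>2 / 18"
    using m by (intro divide_left_mono) auto
  \<comment> \<open>The coefficient 3/4 is 1/2 from the identity plus 1/4 from r^2/8 <= v^2/4 +
    s^2/4. The available v^2/2 covers 1/8 + 1/4 + 1/24.\<close>
  finally have "3 / 4 * s\<^sup>2 \<le> v\<^sup>2 / 24 + e\<^sup>2 / (6 * (real m)\<^sup>2)"
    by simp
  then show ?thesis
    using main r zero_le_power2[of v] unfolding v_def r_def e_def by linarith
qed

text \<open>\<open>step_energy\<close> telescopes; the drift since the snapshot is charged to the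
  steps of the current epoch.\<close>

lemma energy:
  assumes "n \<le> T"
  shows "(\<Sum>t<n. inverse (\<gamma> t) * (F (zh t) \<bullet> (zh t - u))) + (norm (z n - u))\<^sup>2 / 2
      + (\<Sum>t<n. (norm (z t - zh t))\<^sup>2) / 8 \<le> (norm (z 0 - u))\<^sup>2 / 2"
proof -
  define r where "r t = (norm (z t - z (Suc t)))\<^sup>2" for t
  define e where "e t = (norm (z t - z (t - t mod m)))\<^sup>2" for t
  have "(\<Sum>t<n. inverse (\<gamma> t) * (F (zh t) \<bullet> (zh t - u))) + (norm (z n - u))\<^sup>2 / 2
      + (\<Sum>t<n. (norm (z t - zh t))\<^sup>2) / 8
      \<le> (norm (z 0 - u))\<^sup>2 / 2 - (\<Sum>t<n. r t) / 8 + (\<Sum>t<n. e t) / (6 * (real m)\<^sup>2)"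
    using assms
  proof (induction n)
    case (Suc n)
    then show ?case
      using step_energy[of n u] by (simp add: r_def e_def add_divide_distrib)
  qed simp
  \<comment> \<open>Dividing m^2/2 by 6 m^2 gives 1/12, which the available 1/8 of the squared steps
    exceeds.\<close>
  moreover have "(\<Sum>t<n. e t) / (6 * (real m)\<^sup>2) \<le> (\<Sum>t<n. r t) / 8"
  proof -
    have "(\<Sum>t<n. e t) \<le> (\<Sum>t<n. real (t mod m) * (\<Sum>i = t - t mod m..<t. r i))"
    proof (rule sum_mono)
      show "e t \<le> real (t mod m) * (\<Sum>i = t - t mod m..<t. r i)" for t
        using norm_diff_squared_le_sum[of "t - t mod m" t z] by (simp add: e_def r_def)
    qed
    also have "\<dots> \<le> (real m)\<^sup>2 / 2 * (\<Sum>t<n. r t)"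
      using m by (intro sum_lazy_epochs_le) (simp_all add: r_def)
    finally have "(\<Sum>t<n. e t) / (6 * (real m)\<^sup>2) \<le> (real m)\<^sup>2 / 2 * (\<Sum>t<n. r t) / (6 * (real m)\<^sup>2)"
      by (rule divide_right_mono) simp
    also have "\<dots> = (\<Sum>t<n. r t) / 12"
      using m by simp
    also have "\<dots> \<le> (\<Sum>t<n. r t) / 8"
      by (intro divide_left_mono sum_nonneg) (simp_all add: r_def)
    finally show ?thesis .
  qed
  ultimately show ?thesis by linarith
qed

text \<open>\<open>zs\<close> solves the Minty variational inequality, so the regret against
  \<open>zs\<close> is nonnegative and \<open>energy\<close> at \<open>u = zs\<close> controls
  iterates and half-steps at once.\<close>

context
  fixes zs :: 'z
  assumes zs: "0 \<le> F w \<bullet> (w - zs)"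
begin

lemma regret_nonneg: "0 \<le> (\<Sum>t<n. inverse (\<gamma> t) * (F (zh t) \<bullet> (zh t - zs)))"
  using zs gamma_nonneg by (intro sum_nonneg mult_nonneg_nonneg) auto

lemma iterate_bounded:
  assumes "n \<le> T"
  shows "norm (z n - zs) \<le> norm (z 0 - zs)"
proof -
  have "(norm (z n - zs))\<^sup>2 \<le> (norm (z 0 - zs))\<^sup>2"
    using energy[OF assms, of zs] regret_nonneg[of n]
      sum_nonneg[of "{..<n}" "\<lambda>t. (norm (z t - zh t))\<^sup>2", OF zero_le_power2]
    by linarith
  then show ?thesis
    by (rule power2_le_imp_le) simp
qed

lemma sum_half_steps_bounded: "(\<Sum>t<T. (norm (z t - zh t))\<^sup>2) \<le> (2 * norm (z 0 - zs))\<^sup>2"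
proof -
  have "(\<Sum>t<T. (norm (z t - zh t))\<^sup>2) \<le> 4 * (norm (z 0 - zs))\<^sup>2"
    using energy[OF order_refl, of zs] regret_nonneg[of T] zero_le_power2[of "norm (z T - zs)"]
    by linarith
  then show ?thesis
    by (simp add: power_mult_distrib)
qed

text \<open>A squared half-step is one term of a sum bounded by (2 beta)^2 with beta =
  \<open>norm (z 0 - zs)\<close>; the triangle inequality adds the beta of
  \<open>iterate_bounded\<close>.\<close>

lemma half_iterate_bounded:
  assumes t: "t < T"
  shows "norm (zh t - zs) \<le> 3 * norm (z 0 - zs)"
proof -
  have "(norm (z t - zh t))\<^sup>2 \<le> (\<Sum>t<T. (norm (z t - zh t))\<^sup>2)"
    using t by (intro member_le_sum) auto
  then have "(norm (z t - zh t))\<^sup>2 \<le> (2 * norm (z 0 - zs))\<^sup>2"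
    using sum_half_steps_bounded by linarith
  then have "norm (z t - zh t) \<le> 2 * norm (z 0 - zs)"
    by (rule power2_le_imp_le) simp
  moreover have "norm (zh t - zs) \<le> norm (z t - zs) + norm (z t - zh t)"
    using dist_triangle3[of "zh t" zs "z t"] by (simp add: dist_norm norm_minus_commute)
  ultimately show ?thesis
    using iterate_bounded[of t] t by simp
qed

text \<open>A start at \<open>zs\<close> would force \<open>zh 0 = z 0\<close>, hence a vanishing
  gamma; so beta may be divided by. The second claim is \<open>sum_inverse_ge\<close> with B = 2 M
  beta.\<close>

lemma sum_inverse_gamma_ge:
  assumes "\<And>t. t < T \<Longrightarrow> \<gamma> t \<noteq> 0" and T: "1 \<le> T"
  shows "0 < norm (z 0 - zs)"
    and "real T powr (3/2) / (2 * M * norm (z 0 - zs)) \<le> (\<Sum>t<T. inverse (\<gamma> t))"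
proof -
  have "zh 0 \<noteq> z 0"
    using assms(1)[of 0] T gamma_eq_0_iff[of 0] by auto
  moreover have "zh 0 = zs \<and> z 0 = zs" if "norm (z 0 - zs) = 0"
    using half_iterate_bounded[of 0] T that by simp
  ultimately show \<beta>: "0 < norm (z 0 - zs)"
    by auto
  have "(\<Sum>t<T. (\<gamma> t)\<^sup>2) = M\<^sup>2 * (\<Sum>t<T. (norm (z t - zh t))\<^sup>2)"
    by (simp add: LEN_gamma_def power_mult_distrib sum_distrib_left)
  also have "\<dots> \<le> M\<^sup>2 * (2 * norm (z 0 - zs))\<^sup>2"
    by (intro mult_left_mono sum_half_steps_bounded) simp
  finally have "(\<Sum>t<T. (\<gamma> t)\<^sup>2) \<le> (2 * M * norm (z 0 - zs))\<^sup>2"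
    by (simp add: power_mult_distrib mult_ac)
  then show "real T powr (3/2) / (2 * M * norm (z 0 - zs)) \<le> (\<Sum>t<T. inverse (\<gamma> t))"
    using assms gamma_nonneg \<beta> M(1) by (intro sum_inverse_ge) (auto simp: less_le)
qed

end

end

section \<open>The gap of the output\<close>

lemma LEN_lazy_extra_newton:
  assumes "twice_cont_diff f" and "\<rho>-lipschitz_on UNIV (hessian f)"
    and "1 \<le> m" "0 < M" "3 * \<rho> * real m \<le> M" and "LEN f z0 T m M z zh"
  shows "lazy_extra_newton (saddle_op f) (Jac (saddle_op f)) \<rho> M m T z zh"
  using assms Jac_saddle_op(1)[OF assms(1)] lipschitz_Jac_saddle_op[OF assms(1,2)]
  unfolding lazy_extra_newton_def LEN_def
  by (simp add: blinfun.add_left blinfun.scaleR_left)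

text \<open>Chaining the two saddle inequalities through the value at \<open>zs\<close> makes the
  left side of \<open>convex_concave_gap_le\<close> nonnegative. This is the Minty inequality for
  \<open>zs\<close>.\<close>

lemma saddle_point_saddle_op_nonneg:
  assumes "convex_concave f" and "saddle_point f zs" and "f differentiable (at w)"
  shows "0 \<le> saddle_op f w \<bullet> (w - zs)"
proof -
  have "f (fst zs, snd w) \<le> f (fst w, snd zs)"
    using assms(2) unfolding saddle_point_def by (metis order_trans)
  then show ?thesis
    using convex_concave_gap_le[OF assms(1,3), of zs] by simp
qed

text \<open>Supremum and infimum are treated one after the other. \<open>0 \<le> r\<close> keeps
  both balls nonempty, as conditional completeness demands.\<close>

lemma Gap_le:
  assumes r: "0 \<le> r"
    and le: "\<And>u. fst u \<in> cball (fst zs) r \<Longrightarrow> snd u \<in> cball (snd zs) r \<Longrightarrow>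
      f (fst w, snd u) - f (fst u, snd w) \<le> C"
  shows "Gap f zs w r \<le> C"
proof -
  have "(SUP y\<in>cball (snd zs) r. f (fst w, y)) \<le> C + f (x, snd w)" if "x \<in> cball (fst zs) r" for x
    using r le[of "(x, y)" for y] that by (intro cSUP_least) (auto simp: algebra_simps)
  then have "(SUP y\<in>cball (snd zs) r. f (fst w, y)) - C \<le> (INF x\<in>cball (fst zs) r. f (x, snd w))"
    using r by (intro cINF_greatest) (auto simp: algebra_simps)
  then show ?thesis
    by (simp add: Gap_def)
qed

lemma comp_dist_le_norm: "comp_dist z w \<le> norm (z - w)"
  using norm_fst_le[of "fst z - fst w" "snd z - snd w"] norm_snd_le[of "snd z - snd w" "fst z - fst w"]
  by (simp add: comp_dist_def minus_prod_def)

text \<open>The gap ranges over a product of two balls of radius 3 beta, so the squared distance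
  from \<open>zs\<close> may reach 18 beta^2 instead of 9 beta^2.\<close>

lemma norm_squared_le_of_components:
  fixes zs :: "'a::euclidean_space \<times> 'b::euclidean_space"
  assumes "fst u \<in> cball (fst zs) (3 * \<beta>)" and "snd u \<in> cball (snd zs) (3 * \<beta>)"
    and "norm (z0 - zs) = \<beta>"
  shows "(norm (z0 - u))\<^sup>2 \<le> 30 * \<beta>\<^sup>2"
proof -
  define b where "b = norm (zs - u)"
  have "b\<^sup>2 = (norm (fst zs - fst u))\<^sup>2 + (norm (snd zs - snd u))\<^sup>2"
    by (simp add: b_def norm_prod_def)
  also have "\<dots> \<le> (3 * \<beta>)\<^sup>2 + (3 * \<beta>)\<^sup>2"
    using assms(1,2) by (intro add_mono power_mono) (simp_all add: dist_norm)
  finally have b: "b\<^sup>2 \<le> 18 * \<beta>\<^sup>2"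
    by (simp add: power_mult_distrib)
  have "norm (z0 - u) \<le> \<beta> + b"
    using norm_triangle_ineq[of "z0 - zs" "zs - u"] assms(3) by (simp add: b_def)
  then have "(norm (z0 - u))\<^sup>2 \<le> (\<beta> + b)\<^sup>2"
    by (simp add: power_mono)
  \<comment> \<open>Young's inequality with weights that keep the constants rational: 3 + (3/2) 18 =
    30.\<close>
  also have "\<dots> \<le> 3 * \<beta>\<^sup>2 + 3 / 2 * b\<^sup>2"
    using zero_le_power2[of "2 * \<beta> - b"] by (simp add: power2_eq_square algebra_simps)
  finally show ?thesis
    using b by linarith
qed

text \<open>Jensen's inequality in each variable, followed by \<open>convex_concave_gap_le\<close>
  at every averaged point.\<close>

lemma convex_concave_gap_average_le:
  fixes f :: "'a::euclidean_space \<times> 'b::euclidean_space \<Rightarrow> real"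
  assumes cc: "convex_concave f" and diff: "\<And>w. f differentiable (at w)"
    and I: "finite I" "I \<noteq> {}" and a: "\<And>i. i \<in> I \<Longrightarrow> 0 \<le> a i" "sum a I = 1"
  shows "f (fst (\<Sum>i\<in>I. a i *\<^sub>R w i), snd u) - f (fst u, snd (\<Sum>i\<in>I. a i *\<^sub>R w i))
    \<le> (\<Sum>i\<in>I. a i * (saddle_op f (w i) \<bullet> (w i - u)))"
proof -
  have "f (fst (\<Sum>i\<in>I. a i *\<^sub>R w i), snd u) \<le> (\<Sum>i\<in>I. a i * f (fst (w i), snd u))"
    using convex_on_sum[OF I, of UNIV "\<lambda>x. f (x, snd u)" a "fst \<circ> w"] cc a
    by (simp add: convex_concave_def fst_sum)
  moreover have "(\<Sum>i\<in>I. a i * f (fst u, snd (w i))) \<le> f (fst u, snd (\<Sum>i\<in>I. a i *\<^sub>R w i))"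
    using concave_on_sum[OF I, of UNIV "\<lambda>y. f (fst u, y)" a "snd \<circ> w"] cc a
    by (simp add: convex_concave_def snd_sum)
  moreover have "(\<Sum>i\<in>I. a i * (f (fst (w i), snd u) - f (fst u, snd (w i))))
      \<le> (\<Sum>i\<in>I. a i * (saddle_op f (w i) \<bullet> (w i - u)))"
    by (intro sum_mono mult_left_mono convex_concave_gap_le cc diff a(1))
  ultimately show ?thesis
    by (simp add: right_diff_distrib sum_subtractf)
qed

text \<open>The second conclusion makes 3 beta an admissible radius for \<open>eps_saddle\<close>.
  If some gamma vanishes, the output is a zero of the saddle operator and its gap is at most 0;
  otherwise the weighted regret is divided by the sum of the weights.\<close>

lemma LEN_bounds:
  fixes f :: "'a::euclidean_space \<times> 'b::euclidean_space \<Rightarrow> real"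
  assumes f: "twice_cont_diff f" and lip: "\<rho>-lipschitz_on UNIV (hessian f)"
    and cc: "convex_concave f" and zs: "saddle_point f zs"
    and m: "1 \<le> m" and T: "1 \<le> T" and M: "0 < M" "3 * \<rho> * real m \<le> M"
    and LEN: "LEN f z0 T m M z zh"
  defines "\<beta> \<equiv> norm (z0 - zs)"
  shows "\<forall>t<T. z t \<in> cball zs \<beta> \<and> zh t \<in> cball zs (3 * \<beta>)"
    and "comp_dist (LEN_output T M z zh) zs \<le> 3 * \<beta>"
    and "Gap f zs (LEN_output T M z zh) (3 * \<beta>) \<le> 32 * M * \<beta> ^ 3 / real T powr (3/2)"
proof -
  interpret lazy_extra_newton "saddle_op f" "Jac (saddle_op f)" \<rho> M m T z zh
    using f lip m M LEN by (rule LEN_lazy_extra_newton)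
  have diff: "f differentiable (at w)" for w
    using f unfolding twice_cont_diff_def by blast
  note mono = saddle_point_saddle_op_nonneg[OF cc zs diff]
  have z0: "z 0 = z0"
    using LEN by (simp add: LEN_def)
  have \<beta>: "0 \<le> \<beta>"
    by (simp add: \<beta>_def)
  have zh: "zh t \<in> cball zs (3 * \<beta>)" if "t < T" for t
    using half_iterate_bounded[OF mono that] by (simp add: z0 \<beta>_def dist_norm norm_minus_commute)
  then show "\<forall>t<T. z t \<in> cball zs \<beta> \<and> zh t \<in> cball zs (3 * \<beta>)"
    using iterate_bounded[OF mono] by (simp add: z0 \<beta>_def dist_norm norm_minus_commute)
  define out where "out = LEN_output T M z zh"
  have "out \<in> cball zs (3 * \<beta>) \<and> Gap f zs out (3 * \<beta>) \<le> 32 * M * \<beta> ^ 3 / real T powr (3/2)"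
  proof (cases "\<exists>t<T. \<gamma> t = 0")
    case True
    define s where "s = (LEAST t. \<gamma> t = 0)"
    have "\<gamma> s = 0" "s < T"
      unfolding s_def using True by (metis (mono_tags) LeastI, metis (mono_tags) Least_le order_le_less_trans)
    moreover have out: "out = zh s"
      using True by (simp add: out_def LEN_output_def s_def)
    ultimately have "saddle_op f out = 0"
      using stationary by simp
    then have "f (fst out, snd u) - f (fst u, snd out) \<le> 0" for u
      using convex_concave_gap_le[OF cc diff, of out u] by simp
    then have "Gap f zs out (3 * \<beta>) \<le> 0"
      using \<beta> by (intro Gap_le) auto
    also have "\<dots> \<le> 32 * M * \<beta> ^ 3 / real T powr (3/2)"
      using \<beta> M(1) by simp
    finally show ?thesis
      using zh \<open>s < T\<close> out by simp
  next
    case False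
    define G where "G = (\<Sum>t<T. inverse (\<gamma> t))"
    \<comment> \<open>Normalizing the weights makes the output a convex combination, so it stays in
      the ball and Jensen's inequality applies.\<close>
    define a where "a t = inverse G * inverse (\<gamma> t)" for t
    have \<beta>_pos: "0 < \<beta>" and G: "real T powr (3/2) / (2 * M * \<beta>) \<le> G"
      using sum_inverse_gamma_ge[OF mono _ T] False by (auto simp: z0 \<beta>_def G_def)
    have pos: "0 < real T powr (3/2) / (2 * M * \<beta>)"
      using T M(1) \<beta>_pos by simp
    then have G_pos: "0 < G"
      using G by linarith
    have a: "0 \<le> a t" for t
      using G_pos gamma_nonneg by (simp add: a_def)
    have sum_a: "(\<Sum>t<T. a t) = 1"
      using G_pos by (simp add: a_def G_def flip: sum_distrib_left)
    have out: "out = (\<Sum>t<T. a t *\<^sub>R zh t)"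
      using False by (auto simp: out_def LEN_output_def a_def G_def scaleR_sum_right)
    have "out \<in> cball zs (3 * \<beta>)"
      unfolding out using zh by (intro convex_sum convex_cball sum_a a) auto
    moreover have "Gap f zs out (3 * \<beta>) \<le> 32 * M * \<beta> ^ 3 / real T powr (3/2)"
    proof (rule Gap_le)
      fix u
      assume u: "fst u \<in> cball (fst zs) (3 * \<beta>)" "snd u \<in> cball (snd zs) (3 * \<beta>)"
      have "f (fst out, snd u) - f (fst u, snd out) \<le> (\<Sum>t<T. a t * (saddle_op f (zh t) \<bullet> (zh t - u)))"
        unfolding out using T by (intro convex_concave_gap_average_le cc diff sum_a a) (auto simp: lessThan_empty_iff)
      also have "\<dots> = (\<Sum>t<T. inverse (\<gamma> t) * (saddle_op f (zh t) \<bullet> (zh t - u))) / G"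
        by (simp add: a_def sum_distrib_left divide_inverse mult_ac)
      \<comment> \<open>15 is half of the 30 in \<open>norm_squared_le_of_components\<close>; the
        lower bound on \<open>G\<close> doubles it again, leaving slack below 32.\<close>
      also have "\<dots> \<le> 15 * \<beta>\<^sup>2 / G"
      proof (rule divide_right_mono)
        have "(\<Sum>t<T. inverse (\<gamma> t) * (saddle_op f (zh t) \<bullet> (zh t - u))) \<le> (norm (z0 - u))\<^sup>2 / 2"
          using energy[OF order_refl, of u] zero_le_power2[of "norm (z T - u)"]
            sum_nonneg[of "{..<T}" "\<lambda>t. (norm (z t - zh t))\<^sup>2", OF zero_le_power2]
          unfolding z0 by linarith
        then show "(\<Sum>t<T. inverse (\<gamma> t) * (saddle_op f (zh t) \<bullet> (zh t - u))) \<le> 15 * \<beta>\<^sup>2"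
          using norm_squared_le_of_components[OF u, of z0] by (simp add: \<beta>_def)
      qed (use G_pos in simp)
      also have "\<dots> \<le> 15 * \<beta>\<^sup>2 / (real T powr (3/2) / (2 * M * \<beta>))"
        using G by (rule divide_left_mono) (simp, rule mult_pos_pos[OF G_pos pos])
      also have "\<dots> = 30 * M * \<beta> ^ 3 / real T powr (3/2)"
        by (simp add: power2_eq_square power3_eq_cube)
      also have "\<dots> \<le> 32 * M * \<beta> ^ 3 / real T powr (3/2)"
        using M(1) \<beta> by (intro divide_right_mono mult_right_mono) auto
      finally show "f (fst out, snd u) - f (fst u, snd out) \<le> 32 * M * \<beta> ^ 3 / real T powr (3/2)" .
    qed (use \<beta> in simp)
    ultimately show ?thesis ..
  qed
  moreover have "comp_dist out zs \<le> dist zs out"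
    using comp_dist_le_norm[of out zs] by (simp add: dist_norm norm_minus_commute)
  ultimately show "comp_dist (LEN_output T M z zh) zs \<le> 3 * \<beta>"
    and "Gap f zs (LEN_output T M z zh) (3 * \<beta>) \<le> 32 * M * \<beta> ^ 3 / real T powr (3/2)"
    by (simp_all add: out_def)
qed

lemma LEN_eps_saddle:
  fixes f :: "'a::euclidean_space \<times> 'b::euclidean_space \<Rightarrow> real"
  assumes "twice_cont_diff f" and "\<rho>-lipschitz_on UNIV (hessian f)"
    and "convex_concave f" and "saddle_point f zs"
    and "1 \<le> m" and "1 \<le> T" and "0 < \<rho>" and \<epsilon>: "0 < \<epsilon>"
    and LEN: "LEN f z0 T m (3 * \<rho> * real m) z zh"
    and T: "(96 * \<rho> * real m * norm (z0 - zs) ^ 3 / \<epsilon>) powr (2/3) \<le> real T"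
  shows "eps_saddle 1 f z0 zs \<epsilon> (LEN_output T (3 * \<rho> * real m) z zh)"
proof -
  \<comment> \<open>96 is 32 times the 3 in M = 3 rho m.\<close>
  define K where "K = 96 * \<rho> * real m * norm (z0 - zs) ^ 3"
  have K: "0 \<le> K"
    using \<open>0 < \<rho>\<close> by (simp add: K_def)
  have M: "0 < 3 * \<rho> * real m"
    using \<open>0 < \<rho>\<close> \<open>1 \<le> m\<close> by simp
  note bounds = LEN_bounds[OF assms(1-6) M order_refl LEN]
  \<comment> \<open>The exponents 2/3 and 3/2 are reciprocal, so the hypothesis on \<open>T\<close>
    bounds K / epsilon by T^(3/2).\<close>
  have "K / \<epsilon> = ((K / \<epsilon>) powr (2/3)) powr (3/2)"
    using K \<epsilon> by (simp add: powr_powr)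
  also have "\<dots> \<le> real T powr (3/2)"
    using T by (intro powr_mono2) (simp_all add: K_def)
  finally have "K / real T powr (3/2) \<le> \<epsilon>"
    using \<epsilon> \<open>1 \<le> T\<close> by (simp add: field_simps)
  then have "Gap f zs (LEN_output T (3 * \<rho> * real m) z zh) (3 * norm (z0 - zs)) \<le> \<epsilon>"
    using bounds(3) by (simp add: K_def)
  moreover have "1 * comp_dist z0 zs \<le> 3 * norm (z0 - zs)"
    using comp_dist_le_norm[of z0 zs] norm_ge_zero[of "z0 - zs"] by linarith
  ultimately show ?thesis
    using bounds(2) unfolding eps_saddle_def by blast
qed

section \<open>Iteration complexity\<close>

text \<open>The product filter asks for a bound uniform in m >= 1 as epsilon tends to 0 from the
  right. For epsilon < 1 the comparison function is at least 1, so it absorbs the rounding and the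
  extra iteration, with constant K^(2/3) + 2.\<close>

lemma iteration_count_bigo:
  fixes K :: real
  assumes "0 \<le> K"
  shows "(\<lambda>(m, \<epsilon>). real (nat \<lceil>(K * real m / \<epsilon>) powr (2/3)\<rceil> + 1))
    \<in> O[principal {1..} \<times>\<^sub>F at_right 0](\<lambda>(m, \<epsilon>). real m powr (2/3) * \<epsilon> powr (- (2/3)))"
proof (rule bigoI)
  have bound: "norm (real (nat \<lceil>(K * real m / \<epsilon>) powr (2/3)\<rceil> + 1))
      \<le> (K powr (2/3) + 2) * norm (real m powr (2/3) * \<epsilon> powr (- (2/3)))"
    if m: "1 \<le> m" and \<epsilon>: "0 < \<epsilon>" "\<epsilon> < 1" for m :: nat and \<epsilon> :: real
  proof -
    define p where "p = real m powr (2/3) * \<epsilon> powr (- (2/3))"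
    have "(K * real m / \<epsilon>) powr (2/3) = K powr (2/3) * p"
      using assms \<epsilon> by (simp add: p_def powr_mult powr_divide powr_minus_divide)
    moreover have p: "1 * 1 \<le> p"
      unfolding p_def
    proof (intro mult_mono)
      show "1 \<le> real m powr (2/3)"
        using m by (intro ge_one_powr_ge_zero) auto
      show "1 \<le> \<epsilon> powr (- (2/3))"
        using \<epsilon> powr_mono2'[of "- (2/3)" \<epsilon> 1] by simp
    qed auto
    moreover have "real (nat \<lceil>(K * real m / \<epsilon>) powr (2/3)\<rceil>) \<le> (K * real m / \<epsilon>) powr (2/3) + 1"
      using of_int_ceiling_le_add_one powr_ge_zero by (simp add: zero_le_ceiling)
    ultimately have "real (nat \<lceil>(K * real m / \<epsilon>) powr (2/3)\<rceil> + 1) \<le> K powr (2/3) * p + 2 * p"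
      unfolding of_nat_add of_nat_1 by linarith
    then show ?thesis
      unfolding p_def[symmetric] using p by (simp only: distrib_right real_norm_def abs_of_nat)
  qed
  have "\<forall>\<^sub>F \<epsilon> in at_right (0::real). 0 < \<epsilon> \<and> \<epsilon> < 1"
    unfolding eventually_at_right_field by (intro exI[of _ 1]) auto
  then show "\<forall>\<^sub>F x in principal {1..} \<times>\<^sub>F at_right 0.
      norm (case x of (m, \<epsilon>) \<Rightarrow> real (nat \<lceil>(K * real m / \<epsilon>) powr (2/3)\<rceil> + 1))
      \<le> (K powr (2/3) + 2) * norm (case x of (m, \<epsilon>) \<Rightarrow> real m powr (2/3) * \<epsilon> powr (- (2/3)))"
    unfolding eventually_prod_filter using bound
    by (intro exI[of _ "\<lambda>m. 1 \<le> m"] exI[of _ "\<lambda>\<epsilon>. 0 < \<epsilon> \<and> \<epsilon> < 1"])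
      (auto simp: eventually_principal)
qed

theorem theorem4p1:
  shows
    "(\<forall>(f :: 'a::euclidean_space \<times> 'b::euclidean_space \<Rightarrow> real) (\<rho>::real) zs z0 (T::nat) (m::nat)
        (M::real) z zh.
        twice_cont_diff f \<longrightarrow> \<rho>-lipschitz_on UNIV (hessian f) \<longrightarrow> convex_concave f \<longrightarrow>
        saddle_point f zs \<longrightarrow> 1 \<le> m \<longrightarrow> 1 \<le> T \<longrightarrow> 0 < M \<longrightarrow> 3 * \<rho> * real m \<le> M \<longrightarrow>
        LEN f z0 T m M z zh \<longrightarrow>
          (\<forall>t<T. z t \<in> cball zs (norm (z0 - zs)) \<and> zh t \<in> cball zs (3 * norm (z0 - zs))) \<and>
          comp_dist (LEN_output T M z zh) zs \<le> 3 * norm (z0 - zs) \<and>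
          Gap f zs (LEN_output T M z zh) (3 * norm (z0 - zs))
            \<le> 32 * M * norm (z0 - zs) ^ 3 / real T powr (3/2))
     \<and>
     (\<exists>c>0. \<forall>(\<rho>::real)>0. \<forall>\<beta>::real. \<exists>N :: nat \<Rightarrow> real \<Rightarrow> nat.
        (\<lambda>(m, \<epsilon>). real (N m \<epsilon>))
          \<in> O[principal {1..} \<times>\<^sub>F at_right 0](\<lambda>(m, \<epsilon>). real m powr (2/3) * \<epsilon> powr (- (2/3))) \<and>
        (\<forall>m\<ge>1. \<forall>\<epsilon>>0. 1 \<le> N m \<epsilon> \<and>
          (\<forall>(f :: 'a \<times> 'b \<Rightarrow> real) zs z0 z zh.
             twice_cont_diff f \<longrightarrow> \<rho>-lipschitz_on UNIV (hessian f) \<longrightarrow> convex_concave f \<longrightarrow>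
             saddle_point f zs \<longrightarrow> norm (z0 - zs) = \<beta> \<longrightarrow>
             LEN f z0 (N m \<epsilon>) m (3 * \<rho> * real m) z zh \<longrightarrow>
             eps_saddle c f z0 zs \<epsilon> (LEN_output (N m \<epsilon>) (3 * \<rho> * real m) z zh))))"
proof (intro conjI)
  show "\<exists>c>0. \<forall>(\<rho>::real)>0. \<forall>\<beta>::real. \<exists>N :: nat \<Rightarrow> real \<Rightarrow> nat.
        (\<lambda>(m, \<epsilon>). real (N m \<epsilon>))
          \<in> O[principal {1..} \<times>\<^sub>F at_right 0](\<lambda>(m, \<epsilon>). real m powr (2/3) * \<epsilon> powr (- (2/3))) \<and>
        (\<forall>m\<ge>1. \<forall>\<epsilon>>0. 1 \<le> N m \<epsilon> \<and>
          (\<forall>(f :: 'a \<times> 'b \<Rightarrow> real) zs z0 z zh.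
             twice_cont_diff f \<longrightarrow> \<rho>-lipschitz_on UNIV (hessian f) \<longrightarrow> convex_concave f \<longrightarrow>
             saddle_point f zs \<longrightarrow> norm (z0 - zs) = \<beta> \<longrightarrow>
             LEN f z0 (N m \<epsilon>) m (3 * \<rho> * real m) z zh \<longrightarrow>
             eps_saddle c f z0 zs \<epsilon> (LEN_output (N m \<epsilon>) (3 * \<rho> * real m) z zh)))"
  \<comment> \<open>The constant 1 works because \<open>comp_dist\<close> is at most the full
    norm.\<close>
  proof (rule exI[of _ 1], intro conjI allI impI)
    fix \<rho> \<beta> :: real
    assume \<rho>: "0 < \<rho>"
    \<comment> \<open>\<open>\<beta>\<close> ranges over all reals; the absolute value keeps
      \<open>K\<close> nonnegative, and a negative \<open>\<beta>\<close> is never the norm of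
      \<open>z0 - zs\<close>.\<close>
    define K where "K = 96 * \<rho> * \<bar>\<beta>\<bar> ^ 3"
    \<comment> \<open>The added 1 guarantees an iteration even when \<open>K\<close> is
      zero.\<close>
    define N where "N m \<epsilon> = nat \<lceil>(K * real m / \<epsilon>) powr (2/3)\<rceil> + 1" for m :: nat and \<epsilon> :: real
    have N: "(K * real m / \<epsilon>) powr (2/3) \<le> real (N m \<epsilon>)" for m \<epsilon>
      using of_nat_ceiling[of "(K * real m / \<epsilon>) powr (2/3)"] unfolding N_def by linarith
    have K: "K * real m = 96 * \<rho> * real m * norm (z0 - zs) ^ 3"
      if "norm (z0 - zs) = \<beta>" for m :: nat and z0 zs :: "'a \<times> 'b"
      by (simp add: K_def flip: that)
    have "eps_saddle 1 f z0 zs \<epsilon> (LEN_output (N m \<epsilon>) (3 * \<rho> * real m) z zh)"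
      if "1 \<le> m" "0 < \<epsilon>" "twice_cont_diff f" "\<rho>-lipschitz_on UNIV (hessian f)" "convex_concave f"
        "saddle_point f zs" "norm (z0 - zs) = \<beta>" "LEN f z0 (N m \<epsilon>) m (3 * \<rho> * real m) z zh"
      for m \<epsilon> z zh zs z0 and f :: "'a \<times> 'b \<Rightarrow> real"
      using N[of m \<epsilon>] unfolding K[OF that(7)]
      by (intro LEN_eps_saddle[OF that(3-6,1) _ \<rho> that(2,8)]) (simp_all add: N_def)
    moreover have "(\<lambda>(m, \<epsilon>). real (N m \<epsilon>))
        \<in> O[principal {1..} \<times>\<^sub>F at_right 0](\<lambda>(m, \<epsilon>). real m powr (2/3) * \<epsilon> powr (- (2/3)))"
      unfolding N_def using \<rho> by (intro iteration_count_bigo) (simp add: K_def)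
    moreover have "1 \<le> N m \<epsilon>" for m \<epsilon>
      by (simp add: N_def)
    ultimately show "\<exists>N :: nat \<Rightarrow> real \<Rightarrow> nat.
        (\<lambda>(m, \<epsilon>). real (N m \<epsilon>))
          \<in> O[principal {1..} \<times>\<^sub>F at_right 0](\<lambda>(m, \<epsilon>). real m powr (2/3) * \<epsilon> powr (- (2/3))) \<and>
        (\<forall>m\<ge>1. \<forall>\<epsilon>>0. 1 \<le> N m \<epsilon> \<and>
          (\<forall>(f :: 'a \<times> 'b \<Rightarrow> real) zs z0 z zh.
             twice_cont_diff f \<longrightarrow> \<rho>-lipschitz_on UNIV (hessian f) \<longrightarrow> convex_concave f \<longrightarrow>
             saddle_point f zs \<longrightarrow> norm (z0 - zs) = \<beta> \<longrightarrow>
             LEN f z0 (N m \<epsilon>) m (3 * \<rho> * real m) z zh \<longrightarrow>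
             eps_saddle 1 f z0 zs \<epsilon> (LEN_output (N m \<epsilon>) (3 * \<rho> * real m) z zh)))"
      by (intro exI[of _ N]) blast
  qed simp
qed (intro allI impI, intro conjI; rule LEN_bounds; assumption)

end
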